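(* Let an $s$-stage Runge--Kutta method of order at least two be given with coefficients $(A,b)$, $A\in\mathbb{R}^{s\times s}$, $b\in\mathbb{R}^s$, and SSP coefficient $\mathcal{C}(A,b)>0$. Suppose that the first row of $A$ is zero and let $\overline{b}=(\overline{b}_1,\dots,\overline{b}_s):[0,1]\to\mathbb{R}^s$ be defined by $$\overline{b}_1(\theta)=\theta-(1-b_1)\theta^2,\qquad \overline{b}_j(\theta)=\theta^2b_j\quad(2\le j\le s).$$ Then the following statements are true. 1. $(A,\overline{b})$ is an SSP dense output formula of order at least two. 2. If $$b^\top\bigl(I+\mathcal{C}(A,b)A\bigr)^{-1}e\le 1-\frac{\mathcal{C}(A,b)}{4},$$ then $\mathcal{C}(A,\overline{b})=\mathcal{C}(A,b)$. 3. If $\mathcal{C}(A,b)\le 2$, then $\mathcal{C}(A,\overline{b})=\mathcal{C}(A,b)$.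
   Context: An $s$-stage Runge--Kutta method $(A,b)$, with $A=(a_{i,j})\in\mathbb{R}^{s\times s}$ and $b\in\mathbb{R}^s$, approximates solutions of $u'=f(u)$ by $y_i=u_n+h\sum_{j=1}^s a_{i,j}f(y_j)$, $u_{n+1}=u_n+h\sum_{j=1}^s b_jf(y_j)$. Its abscissas are $c_i:=\sum_{j=1}^s a_{i,j}$. It has order at least two if $\sum_{j=1}^s b_j=1$ and $\sum_{j=1}^s b_jc_j=1/2$. A dense output formula for it is given by a function $\overline{b}=(\overline{b}_1,\dots,\overline{b}_s):[0,1]\to\mathbb{R}^s$, via $u_{n+\theta}=u_n+h\sum_{j=1}^s\overline{b}_j(\theta)f(y_j)$. It has order at least two if for all $\theta\in[0,1]$: $\sum_{j=1}^s\overline{b}_j(\theta)=\theta$ and $\sum_{j=1}^s\overline{b}_j(\theta)c_j=\theta^2/2$. Let $e=(1,\dots,1)^\top\in\mathbb{R}^s$; all matrix/vector inequalities are componentwise. For $r\ge 0$ such that $(I+rA)^{-1}$ exists consider the conditions (i) $A(I+rA)^{-1}\ge 0$ and $rA(I+rA)^{-1}e\le 1$; (ii) $b^\top(I+rA)^{-1}\ge 0$ and $rb^\top(I+rA)^{-1}e\le 1$; (iii) $\overline{b}(\theta)^\top(I+rA)^{-1}\ge 0$ and $r\overline{b}(\theta)^\top(I+rA)^{-1}e\le 1$ for all $0\le\theta\le 1$. $\mathcal{C}(A,b)$ is the supremum of the set of $r\ge 0$ for which $(I+rA)^{-1}$ exists and (i), (ii) hold (and $0$ if this set is empty). $\mathcal{C}(A,\overline{b})$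 is the supremum of the set of $r\ge 0$ for which $(I+rA)^{-1}$ exists and (i), (iii) hold (and $0$ if this set is empty). Suprema are taken in $[0,\infty]$. A dense output formula is SSP (strong stability preserving) if $\mathcal{C}(A,\overline{b})>0$. *)

theory Defs
  imports "HOL-Analysis.Analysis"
begin

text \<open>
  The finite index type stands for the stages, so the number of stages is its cardinality.
  The orders on vectors and matrices are the componentwise ones of the library, \<open>mat 1\<close> is the
  identity matrix, and the vector \<open>1\<close> is \<open>e = (1, \<dots>, 1)\<close>; hence \<open>w \<bullet> 1\<close>
  is the sum of the components of \<open>w\<close>.
\<close>

definition abscissas :: "real ^ 's ^ 's \<Rightarrow> real ^ 's"
  where "abscissas A = (\<chi> i. \<Sum>j\<in>UNIV. A $ i $ j)"

definition rk_order_ge_2 :: "real ^ 's ^ 's \<Rightarrow> real ^ 's \<Rightarrow> bool"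
  where "rk_order_ge_2 A b \<longleftrightarrow>
    (\<Sum>j\<in>UNIV. b $ j) = 1 \<and> (\<Sum>j\<in>UNIV. b $ j * abscissas A $ j) = 1 / 2"

text \<open>
  A dense output formula is a function on \<open>[0, 1]\<close>; all definitions below depend only on its
  values there.
\<close>

definition dense_order_ge_2 :: "real ^ 's ^ 's \<Rightarrow> (real \<Rightarrow> real ^ 's) \<Rightarrow> bool"
  where "dense_order_ge_2 A bb \<longleftrightarrow>
    (\<forall>\<theta>\<in>{0..1}. (\<Sum>j\<in>UNIV. bb \<theta> $ j) = \<theta> \<and>
       (\<Sum>j\<in>UNIV. bb \<theta> $ j * abscissas A $ j) = \<theta>\<^sup>2 / 2)"

definition resolvent :: "real ^ 's ^ 's \<Rightarrow> real \<Rightarrow> real ^ 's ^ 's"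
  where "resolvent A r = matrix_inv (mat 1 + r *\<^sub>R A)"

definition stage_cond :: "real ^ 's ^ 's \<Rightarrow> real \<Rightarrow> bool"
  where "stage_cond A r \<longleftrightarrow>
    0 \<le> A ** resolvent A r \<and> (r *\<^sub>R (A ** resolvent A r)) *v 1 \<le> 1"

definition weight_cond :: "real ^ 's ^ 's \<Rightarrow> real ^ 's \<Rightarrow> real \<Rightarrow> bool"
  where "weight_cond A w r \<longleftrightarrow>
    0 \<le> w v* resolvent A r \<and> r * ((w v* resolvent A r) \<bullet> 1) \<le> 1"

definition ssp_radii :: "real ^ 's ^ 's \<Rightarrow> real ^ 's \<Rightarrow> real set"
  where "ssp_radii A b =
    {r. 0 \<le> r \<and> invertible (mat 1 + r *\<^sub>R A) \<and> stage_cond A r \<and> weight_cond A b r}"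

definition dense_ssp_radii :: "real ^ 's ^ 's \<Rightarrow> (real \<Rightarrow> real ^ 's) \<Rightarrow> real set"
  where "dense_ssp_radii A bb =
    {r. 0 \<le> r \<and> invertible (mat 1 + r *\<^sub>R A) \<and> stage_cond A r \<and>
        (\<forall>\<theta>\<in>{0..1}. weight_cond A (bb \<theta>) r)}"

text \<open>
  The supremum in \<open>[0, \<infinity>]\<close>. The empty set is treated separately because its supremum in
  \<^typ>\<open>ereal\<close> is \<open>-\<infinity>\<close>.
\<close>

definition sup_radius :: "real set \<Rightarrow> ereal"
  where "sup_radius S = (if S = {} then 0 else (SUP r\<in>S. ereal r))"

definition ssp_coeff :: "real ^ 's ^ 's \<Rightarrow> real ^ 's \<Rightarrow> ereal"
  where "ssp_coeff A b = sup_radius (ssp_radii A b)"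

definition dense_ssp_coeff :: "real ^ 's ^ 's \<Rightarrow> (real \<Rightarrow> real ^ 's) \<Rightarrow> ereal"
  where "dense_ssp_coeff A bb = sup_radius (dense_ssp_radii A bb)"

definition ssp_dense_output :: "real ^ 's ^ 's \<Rightarrow> (real \<Rightarrow> real ^ 's) \<Rightarrow> bool"
  where "ssp_dense_output A bb \<longleftrightarrow> 0 < dense_ssp_coeff A bb"

end

theory Submission
  imports Defs
begin

text \<open>
  Since the first row of \<open>A\<close> vanishes, \<open>e\<^sub>1\<^sup>T\<close> is fixed by the resolvent
  \<open>R = (I + rA)\<^sup>-\<^sup>1\<close>. As the dense weights are \<open>(\<theta> - \<theta>\<^sup>2) e\<^sub>1 + \<theta>\<^sup>2 b\<close>, the dense
  conditions at an admissible \<open>r\<close> reduce to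
  \<open>r (\<theta> - \<theta>\<^sup>2) + \<theta>\<^sup>2 r \<beta> \<le> 1\<close> with \<open>\<beta> = b\<^sup>T R e\<close>. From \<open>r \<beta> \<le> 1\<close> and \<open>r \<le> 2\<close> the left
  side is at most \<open>1 - (1 - \<theta>)\<^sup>2\<close>, and from \<open>\<beta> \<le> 1 - r/4\<close> it is at most
  \<open>1 - (1 - r \<theta>/2)\<^sup>2\<close>. Downward closure of the admissible radii provides a positive one
  below 2, and their closedness makes the SSP coefficient itself admissible when it is finite.
\<close>

section \<open>Monotonicity, limits and distributivity of matrix products\<close>

lemma matrix_mult_nonneg:
  fixes A :: "real ^ 'n ^ 'm" and B :: "real ^ 'p ^ 'n"
  assumes "0 \<le> A" "0 \<le> B"
  shows "0 \<le> A ** B"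
  using assms by (auto simp: less_eq_vec_def matrix_matrix_mult_def intro!: sum_nonneg)

lemma vector_matrix_mult_nonneg:
  fixes v :: "real ^ 'm" and A :: "real ^ 'n ^ 'm"
  assumes "0 \<le> v" "0 \<le> A"
  shows "0 \<le> v v* A"
  using assms by (auto simp: less_eq_vec_def vector_matrix_mult_def intro!: sum_nonneg)

lemma matrix_vector_mult_mono:
  fixes A :: "real ^ 'n ^ 'm"
  assumes "0 \<le> A" "x \<le> y"
  shows "A *v x \<le> A *v y"
  using assms
  by (auto simp: less_eq_vec_def matrix_vector_mult_def intro!: sum_mono mult_left_mono)

lemma inner_mono_nonneg:
  fixes v x y :: "real ^ 'n"
  assumes "0 \<le> v" "x \<le> y"
  shows "v \<bullet> x \<le> v \<bullet> y"
  using assms by (auto simp: less_eq_vec_def inner_vec_def intro!: sum_mono mult_left_mono)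

lemma tendsto_matrix_mult:
  fixes f :: "'a \<Rightarrow> real ^ 'n ^ 'm" and g :: "'a \<Rightarrow> real ^ 'p ^ 'n"
  assumes "(f \<longlongrightarrow> A) F" "(g \<longlongrightarrow> B) F"
  shows "((\<lambda>x. f x ** g x) \<longlongrightarrow> A ** B) F"
  unfolding matrix_matrix_mult_def
  by (intro tendsto_vec_lambda tendsto_sum tendsto_mult tendsto_vec_nth assms)

lemma matrix_mult_add_rdistrib:
  fixes A B :: "real ^ 'n ^ 'm" and C :: "real ^ 'p ^ 'n"
  shows "(A + B) ** C = A ** C + B ** C"
  by (simp add: vec_eq_iff matrix_matrix_mult_def distrib_right sum.distrib)

section \<open>Algebra of the resolvent\<close>

lemma resolvent_inverse:
  assumes "invertible (mat 1 + r *\<^sub>R A)"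
  shows "resolvent A r ** (mat 1 + r *\<^sub>R A) = mat 1"
    and "(mat 1 + r *\<^sub>R A) ** resolvent A r = mat 1"
  using someI_ex[OF assms[unfolded invertible_def]] by (simp_all add: resolvent_def matrix_inv_def)

text \<open>For square matrices a left inverse is two-sided and unique. Later proofs therefore only
  exhibit a left inverse, by a formula or as a limit, to get invertibility and the resolvent at
  once.\<close>

lemma resolvent_eqI:
  assumes "X ** (mat 1 + r *\<^sub>R A) = mat 1"
  shows "invertible (mat 1 + r *\<^sub>R A)" "resolvent A r = X"
proof -
  show inv: "invertible (mat 1 + r *\<^sub>R A)"
    using assms invertible_left_inverse by blast
  have "X ** ((mat 1 + r *\<^sub>R A) ** resolvent A r) = X"
    by (simp add: resolvent_inverse(2)[OF inv])
  then show "resolvent A r = X"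
    by (simp add: matrix_mul_assoc assms)
qed

text \<open>Carries information about \<open>A ** resolvent A r\<close> over to the resolvent: entry
  bounds from the stage condition, and identity rows where \<open>A\<close> has zero rows.\<close>

lemma resolvent_complement:
  assumes "invertible (mat 1 + r *\<^sub>R A)"
  shows "resolvent A r = mat 1 - r *\<^sub>R (A ** resolvent A r)"
proof -
  have "(mat 1 + r *\<^sub>R A) ** resolvent A r = mat 1"
    by (rule resolvent_inverse(2)[OF assms])
  then show ?thesis
    by (simp add: matrix_mult_add_rdistrib scalar_matrix_assoc algebra_simps)
qed

section \<open>Substochastic matrices\<close>

text \<open>Look at a smallest component of \<open>x\<close>.\<close>

lemma substochastic_nonneg:
  fixes P :: "real ^ 'n ^ 'n"
  assumes P: "0 \<le> P" "P *v 1 \<le> 1" and q: "0 \<le> q" "q < 1"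
    and x: "0 \<le> x - q *\<^sub>R (P *v x)"
  shows "0 \<le> x"
proof -
  obtain k where k: "\<And>i. x $ k \<le> x $ i"
    using ex_is_arg_min_if_finite[of UNIV "\<lambda>i. x $ i"] by (force simp: is_arg_min_linorder)
  have "0 \<le> x $ k"
  proof (rule ccontr)
    assume neg: "\<not> 0 \<le> x $ k"
    \<comment> \<open>Multiplying the negative number \<open>x $ k\<close> by a row sum that is at
      most 1 cannot decrease it.\<close>
    have "x $ k \<le> x $ k * (\<Sum>j\<in>UNIV. P $ k $ j)"
      using P(2) neg by (auto simp: less_eq_vec_def matrix_vector_mult_def mult_le_cancel_left2)
    also have "\<dots> \<le> (\<Sum>j\<in>UNIV. P $ k $ j * x $ j)"
      using P(1) k
      by (auto simp: sum_distrib_left mult.commute[of "x $ k"] less_eq_vec_def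
          intro!: sum_mono mult_left_mono)
    finally have "q * x $ k \<le> q * (P *v x) $ k"
      using q by (simp add: matrix_vector_mult_def mult_left_mono)
    moreover have "q * (P *v x) $ k \<le> x $ k"
      using x by (simp add: less_eq_vec_def)
    ultimately have "0 \<le> (1 - q) * x $ k"
      by (simp add: algebra_simps)
    with q neg show False
      by (simp add: zero_le_mult_iff)
  qed
  with k show ?thesis
    by (auto simp: less_eq_vec_def intro: order_trans)
qed

text \<open>\<open>N\<close> is the Neumann series of the powers of \<open>q *\<^sub>R P\<close>,
  whose row sums are at most 1/(1 - q). Instead of summing it, the proof uses that a vector is
  nonnegative whenever its image under \<open>?M\<close> is.\<close>

lemma substochastic_inverse:
  fixes P :: "real ^ 'n ^ 'n"
  assumes P: "0 \<le> P" "P *v 1 \<le> 1" and q: "0 \<le> q" "q < 1"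
  obtains N where "N ** (mat 1 - q *\<^sub>R P) = mat 1" "0 \<le> N" "(1 - q) *\<^sub>R (N *v 1) \<le> 1"
proof -
  let ?M = "mat 1 - q *\<^sub>R P"
  have M: "?M *v x = x - q *\<^sub>R (P *v x)" for x
    by (simp add: matrix_vector_mult_diff_rdistrib scaleR_matrix_vector_assoc)
  have nonneg: "0 \<le> x" if "0 \<le> ?M *v x" for x
    using substochastic_nonneg[OF P q] that by (simp add: M)
  have "x = 0" if "?M *v x = 0" for x
  proof -
    have "?M *v (- x) = 0"
      using that M[of x] M[of "- x"] by (simp add: linear_neg[OF matrix_vector_mul_linear])
    then show ?thesis
      using nonneg[of x] nonneg[of "- x"] that by (auto intro: antisym)
  qed
  then obtain N where N: "N ** ?M = mat 1"
    using matrix_left_invertible_ker by blast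
  then have MN: "?M ** N = mat 1"
    using matrix_left_right_inverse by blast
  have "0 \<le> N"
  proof -
    \<comment> \<open>\<open>N *v axis j 1\<close> is column j of \<open>N\<close>;
      \<open>?M\<close> maps it to a unit vector.\<close>
    have "0 \<le> N *v axis j 1" for j
      by (rule nonneg) (simp add: matrix_vector_mul_assoc MN less_eq_vec_def axis_def)
    then show ?thesis
      by (simp add: less_eq_vec_def matrix_vector_mul_component inner_axis)
  qed
  moreover have "0 \<le> 1 - (1 - q) *\<^sub>R (N *v 1)"
  proof (rule nonneg)
    have "?M *v (1 - (1 - q) *\<^sub>R (N *v 1)) = ?M *v 1 - (1 - q) *\<^sub>R (?M *v (N *v 1))"
      by (simp only: matrix_vector_mult_diff_distrib matrix_vector_mult_scaleR)
    also have "\<dots> = q *\<^sub>R (1 - P *v 1)"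
      by (simp only: matrix_vector_mul_assoc MN matrix_vector_mul_lid M) (simp add: algebra_simps)
    finally show "0 \<le> ?M *v (1 - (1 - q) *\<^sub>R (N *v 1))"
      using P q by (simp add: less_eq_vec_def)
  qed
  ultimately show ?thesis
    using N that by simp
qed

section \<open>Downward closure of the admissible radii\<close>

text \<open>With \<open>P = rA(I + rA)\<^sup>-\<^sup>1\<close> and \<open>q = 1 - s/r\<close> one has \<open>I + sA = (I - qP)(I + rA)\<close>.\<close>

lemma ssp_radii_downward:
  fixes A :: "real ^ 'n ^ 'n"
  assumes r: "r \<in> ssp_radii A b" and s: "0 < s" "s \<le> r"
  shows "s \<in> ssp_radii A b"
proof -
  define R where "R = resolvent A r"
  define P where "P = r *\<^sub>R (A ** R)"
  define q where "q = 1 - s / r"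
  have q: "0 \<le> q" "q < 1" and sq: "s = (1 - q) * r"
    using s by (auto simp: q_def)
  have inv: "invertible (mat 1 + r *\<^sub>R A)" and AR: "0 \<le> A ** R" and P1: "P *v 1 \<le> 1"
    and bR: "0 \<le> b v* R" "r * ((b v* R) \<bullet> 1) \<le> 1"
    using r by (auto simp: ssp_radii_def stage_cond_def weight_cond_def R_def P_def)
  have P: "0 \<le> P"
    using AR s by (auto simp: P_def less_eq_vec_def)
  obtain N where N: "N ** (mat 1 - q *\<^sub>R P) = mat 1" "0 \<le> N" "(1 - q) *\<^sub>R (N *v 1) \<le> 1"
    using substochastic_inverse[OF P P1 q] .
  have RD: "R ** (mat 1 + r *\<^sub>R A) = mat 1"
    by (simp add: R_def resolvent_inverse(1)[OF inv])
  have "P ** (mat 1 + r *\<^sub>R A) = r *\<^sub>R A"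
    by (simp add: P_def RD flip: scalar_matrix_assoc matrix_mul_assoc)
  moreover have "(mat 1 + s *\<^sub>R A) + q *\<^sub>R (r *\<^sub>R A) = mat 1 + r *\<^sub>R A"
    by (simp add: sq algebra_simps flip: scaleR_add_left)
  moreover have "(mat 1 - q *\<^sub>R P) ** X + q *\<^sub>R (P ** X) = X" for X :: "real ^ 'n ^ 'n"
    by (simp add: scalar_matrix_assoc flip: matrix_mult_add_rdistrib)
  ultimately have "mat 1 + s *\<^sub>R A = (mat 1 - q *\<^sub>R P) ** (mat 1 + r *\<^sub>R A)"
    by (metis add_right_cancel)
  \<comment> \<open>\<open>N\<close> undoes the left factor and \<open>R\<close> the right one, so
    \<open>R ** N\<close> is the resolvent at \<open>s\<close>.\<close>
  then have "(R ** N) ** (mat 1 + s *\<^sub>R A) = R ** ((N ** (mat 1 - q *\<^sub>R P)) ** (mat 1 + r *\<^sub>R A))"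
    by (simp add: matrix_mul_assoc)
  then have "(R ** N) ** (mat 1 + s *\<^sub>R A) = mat 1"
    by (simp add: N RD)
  note res = resolvent_eqI[OF this]
  \<comment> \<open>The factor \<open>s\<close> splits: \<open>r\<close> is absorbed into
    \<open>P\<close>, and \<open>1 - q\<close> scales \<open>N *v 1\<close> to at most 1. The
    weights below are treated the same way.\<close>
  have "(s *\<^sub>R (A ** (R ** N))) *v 1 = P *v ((1 - q) *\<^sub>R (N *v 1))"
    by (simp add: sq P_def matrix_vector_mul_assoc matrix_mul_assoc mult.commute
        matrix_vector_mult_scaleR flip: scaleR_matrix_vector_assoc scalar_matrix_assoc)
  also have "\<dots> \<le> 1"
    using matrix_vector_mult_mono[OF P N(3)] P1 by (rule order_trans)
  finally have stage: "stage_cond A s"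
    using matrix_mult_nonneg[OF AR N(2)] by (simp add: stage_cond_def res matrix_mul_assoc)
  have "s * ((b v* (R ** N)) \<bullet> 1) = r * ((b v* R) \<bullet> ((1 - q) *\<^sub>R (N *v 1)))"
    by (simp add: sq dot_lmul_matrix matrix_vector_mul_assoc flip: vector_matrix_mul_assoc)
  also have "\<dots> \<le> r * ((b v* R) \<bullet> 1)"
    using inner_mono_nonneg[OF bR(1) N(3)] s by (simp add: mult_left_mono)
  finally have "weight_cond A b s"
    using vector_matrix_mult_nonneg[OF bR(1) N(2)] bR(2)
    by (simp add: weight_cond_def res vector_matrix_mul_assoc)
  with stage res(1) s show ?thesis
    by (simp add: ssp_radii_def)
qed

section \<open>Closedness of the admissible radii\<close>

text \<open>The resolvent is I - P, where P is nonnegative with row sums at most 1; so each entry is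
  a difference of two numbers in [0, 1].\<close>

lemma stage_cond_resolvent_bound:
  assumes "0 \<le> r" "invertible (mat 1 + r *\<^sub>R A)" "stage_cond A r"
  shows "\<bar>resolvent A r $ i $ j\<bar> \<le> 1"
proof -
  define P where "P = r *\<^sub>R (A ** resolvent A r)"
  have P: "0 \<le> P $ i $ j" for i j
    using assms by (auto simp: stage_cond_def less_eq_vec_def P_def)
  have "P $ i $ j \<le> (\<Sum>j\<in>UNIV. P $ i $ j)"
    by (rule member_le_sum) (use P in auto)
  also have "\<dots> \<le> 1"
    using assms(3)
    by (auto simp: stage_cond_def less_eq_vec_def matrix_vector_mult_def P_def)
  finally have "P $ i $ j \<le> 1" .
  moreover have "resolvent A r = mat 1 - P"
    using resolvent_complement[OF assms(2)] by (simp add: P_def)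
  ultimately show ?thesis
    using P[of i j] by (cases "i = j") (auto simp: mat_def)
qed

text \<open>On admissible radii the resolvent is bounded, so along a convergent sequence of radii it
  has a limit point, which is the resolvent at the limit.\<close>

lemma closed_ssp_radii:
  fixes A :: "real ^ 'n ^ 'n"
  shows "closed (ssp_radii A b)"
  unfolding closed_sequential_limits
proof (intro allI impI, elim conjE)
  fix \<rho> r
  assume rad: "\<forall>n. \<rho> n \<in> ssp_radii A b" and lim: "\<rho> \<longlonglongrightarrow> r"
  define R where "R n = resolvent A (\<rho> n)" for n
  have rho: "0 \<le> \<rho> n" "invertible (mat 1 + \<rho> n *\<^sub>R A)" "stage_cond A (\<rho> n)"
    "weight_cond A b (\<rho> n)" for n
    using rad by (auto simp: ssp_radii_def)
  have "norm (R n) \<le> (\<Sum>i\<in>(UNIV :: 'n set). \<Sum>j\<in>(UNIV :: 'n set). 1)" for n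
  proof -
    have "norm (R n) \<le> (\<Sum>i\<in>UNIV. norm (R n $ i))"
      by (simp add: norm_vec_def L2_set_le_sum)
    also have "\<dots> \<le> (\<Sum>i\<in>UNIV. \<Sum>j\<in>UNIV. \<bar>R n $ i $ j\<bar>)"
      by (intro sum_mono norm_le_l1_cart)
    also have "\<dots> \<le> (\<Sum>i\<in>(UNIV :: 'n set). \<Sum>j\<in>(UNIV :: 'n set). 1)"
      unfolding R_def by (intro sum_mono stage_cond_resolvent_bound[OF rho(1-3)])
    finally show ?thesis .
  qed
  then have "bounded (range R)"
    by (auto simp: bounded_iff)
  then obtain L \<phi> where \<phi>: "strict_mono (\<phi> :: nat \<Rightarrow> nat)" and L: "(R \<circ> \<phi>) \<longlonglongrightarrow> L"
    using bounded_imp_convergent_subsequence by blast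
  have r: "(\<lambda>n. \<rho> (\<phi> n)) \<longlonglongrightarrow> r"
    using LIMSEQ_subseq_LIMSEQ[OF lim \<phi>] by (simp add: o_def)
  have RL: "(\<lambda>n. R (\<phi> n)) \<longlonglongrightarrow> L"
    using L by (simp add: o_def)
  have AL: "(\<lambda>n. A ** R (\<phi> n)) \<longlonglongrightarrow> A ** L"
    by (intro tendsto_matrix_mult tendsto_const RL)
  have bL: "(\<lambda>n. b v* R (\<phi> n)) \<longlonglongrightarrow> b v* L"
    unfolding vector_matrix_mult_def
    by (intro tendsto_vec_lambda tendsto_sum tendsto_mult tendsto_vec_nth tendsto_const RL)
  \<comment> \<open>Invertibility at the limit radius is not given; passing to the limit in the
    inverse identity yields it, with \<open>L\<close> as the inverse.\<close>
  have "(\<lambda>n. R (\<phi> n) ** (mat 1 + \<rho> (\<phi> n) *\<^sub>R A)) \<longlonglongrightarrow> L ** (mat 1 + r *\<^sub>R A)"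
    by (intro tendsto_matrix_mult tendsto_add tendsto_scaleR tendsto_const r RL)
  moreover have "R (\<phi> n) ** (mat 1 + \<rho> (\<phi> n) *\<^sub>R A) = mat 1" for n
    by (simp add: R_def resolvent_inverse(1)[OF rho(2)])
  ultimately have "L ** (mat 1 + r *\<^sub>R A) = mat 1"
    by (simp add: LIMSEQ_const_iff)
  note res = resolvent_eqI[OF this]
  have "0 \<le> r"
    by (rule LIMSEQ_le_const[OF r]) (use rho in auto)
  moreover have "0 \<le> (A ** L) $ i $ j" for i j
    by (rule LIMSEQ_le_const[OF tendsto_vec_nth[OF tendsto_vec_nth[OF AL]]])
      (use rho(3) in \<open>auto simp: stage_cond_def less_eq_vec_def R_def\<close>)
  moreover have "((r *\<^sub>R (A ** L)) *v 1) $ i \<le> 1" for i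
  proof (rule LIMSEQ_le_const2)
    show "(\<lambda>n. ((\<rho> (\<phi> n) *\<^sub>R (A ** R (\<phi> n))) *v 1) $ i) \<longlonglongrightarrow> ((r *\<^sub>R (A ** L)) *v 1) $ i"
      unfolding matrix_vector_mult_def
      by (intro tendsto_vec_lambda tendsto_sum tendsto_mult tendsto_vec_nth tendsto_const
          tendsto_scaleR AL r)
  qed (use rho(3) in \<open>auto simp: stage_cond_def less_eq_vec_def R_def\<close>)
  moreover have "0 \<le> (b v* L) $ j" for j
    by (rule LIMSEQ_le_const[OF tendsto_vec_nth[OF bL]])
      (use rho(4) in \<open>auto simp: weight_cond_def less_eq_vec_def R_def\<close>)
  moreover have "r * ((b v* L) \<bullet> 1) \<le> 1"
    by (rule LIMSEQ_le_const2[OF tendsto_mult[OF r tendsto_inner[OF bL tendsto_const]]])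
      (use rho(4) in \<open>auto simp: weight_cond_def R_def\<close>)
  ultimately show "r \<in> ssp_radii A b"
    by (simp add: ssp_radii_def stage_cond_def weight_cond_def less_eq_vec_def res)
qed

section \<open>Suprema of sets of radii\<close>

lemma sup_radius_ge: "r \<in> S \<Longrightarrow> ereal r \<le> sup_radius S"
  by (auto simp: sup_radius_def intro: SUP_upper)

text \<open>Nonnegativity of the elements of \<open>T\<close> covers the case of empty
  \<open>S\<close>, whose supremum is set to 0.\<close>

lemma sup_radius_mono:
  assumes "S \<subseteq> T" "T \<subseteq> {0..}"
  shows "sup_radius S \<le> sup_radius T"
proof (cases "S = {}")
  case True
  show ?thesis
  proof (cases "T = {}")
    case False
    then obtain r where "r \<in> T" "0 \<le> r"
      using assms by auto
    then have "0 \<le> sup_radius T"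
      using sup_radius_ge[of r T] by (simp add: order_trans[of 0 "ereal r"])
    then show ?thesis
      using True by (simp add: sup_radius_def)
  qed (simp add: True)
next
  case False
  then show ?thesis
    using assms by (auto simp: sup_radius_def intro: SUP_subset_mono)
qed

text \<open>A finite supremum is a limit of elements of \<open>S\<close>. Positivity excludes the
  empty set.\<close>

lemma sup_radius_mem:
  assumes "closed S" "sup_radius S = ereal r" "0 < r"
  shows "r \<in> S"
proof -
  have sup: "(SUP x\<in>S. ereal x) = ereal r"
    using assms by (auto simp: sup_radius_def split: if_splits)
  have "\<exists>x\<in>S. dist x r < e" if "0 < e" for e
  proof -
    have "ereal (r - e) < (SUP x\<in>S. ereal x)"
      using that by (simp add: sup)
    then obtain x where x: "x \<in> S" "r - e < x"
      by (auto simp: less_SUP_iff)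
    then have "ereal x \<le> ereal r"
      using sup by (metis SUP_upper)
    with x show ?thesis
      by (auto simp: dist_real_def intro!: bexI[of _ x])
  qed
  then show ?thesis
    using assms(1) closed_approachable by blast
qed

section \<open>The dense output formula\<close>

lemma weight_cond_dense:
  fixes A :: "real ^ 'n ^ 'n"
  assumes row: "\<And>j. A $ i $ j = 0" and inv: "invertible (mat 1 + r *\<^sub>R A)"
    and w: "weight_cond A b r" and \<theta>: "\<theta> \<in> {0..1}"
    and bound: "r * (\<theta> - \<theta>\<^sup>2) + \<theta>\<^sup>2 * (r * ((b v* resolvent A r) \<bullet> 1)) \<le> 1"
  shows "weight_cond A ((\<theta> - \<theta>\<^sup>2) *\<^sub>R axis i 1 + \<theta>\<^sup>2 *\<^sub>R b) r"
proof -
  \<comment> \<open>Row \<open>i\<close> of \<open>A ** resolvent A r\<close> vanishes together with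
    row \<open>i\<close> of \<open>A\<close>.\<close>
  have "resolvent A r $ i $ j = (mat 1 :: real ^ 'n ^ 'n) $ i $ j" for j
    by (subst resolvent_complement[OF inv]) (simp add: matrix_matrix_mult_def row)
  then have e: "axis i 1 v* resolvent A r = axis i 1"
    by (simp add: vec_eq_iff vector_matrix_mult_def axis_def mat_def if_distrib if_distribR
        cong: if_cong)
  have eq: "((\<theta> - \<theta>\<^sup>2) *\<^sub>R axis i 1 + \<theta>\<^sup>2 *\<^sub>R b) v* resolvent A r
      = (\<theta> - \<theta>\<^sup>2) *\<^sub>R axis i 1 + \<theta>\<^sup>2 *\<^sub>R (b v* resolvent A r)"
    by (simp add: vector_matrix_left_distrib e scaleR_vector_matrix_assoc)
  have "\<theta>\<^sup>2 \<le> \<theta>"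
    using \<theta> by (simp add: power2_eq_square mult_left_le)
  then have "0 \<le> (\<theta> - \<theta>\<^sup>2) *\<^sub>R axis i 1 + \<theta>\<^sup>2 *\<^sub>R (b v* resolvent A r)"
    using w by (auto simp: weight_cond_def less_eq_vec_def axis_def)
  moreover have "axis i 1 \<bullet> (1 :: real ^ 'n) = 1"
    by (simp add: inner_axis')
  ultimately show ?thesis
    using bound unfolding weight_cond_def eq by (simp add: inner_add_left algebra_simps)
qed

theorem theorem5:
  fixes A :: "real ^ ('s::{finite,linorder}) ^ ('s::{finite,linorder})"
    and b :: "real ^ ('s::{finite,linorder})"
    and bb :: "real \<Rightarrow> real ^ ('s::{finite,linorder})"
    and i1 :: "'s::{finite,linorder}"
  assumes first: "\<And>j. i1 \<le> j"
    and order: "rk_order_ge_2 A b"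
    and ssp: "0 < ssp_coeff A b"
    and first_row: "\<And>j. A $ i1 $ j = 0"
    and bb_first: "\<And>\<theta>. \<theta> \<in> {0..1} \<Longrightarrow> bb \<theta> $ i1 = \<theta> - (1 - b $ i1) * \<theta>\<^sup>2"
    and bb_other: "\<And>\<theta> j. \<theta> \<in> {0..1} \<Longrightarrow> j \<noteq> i1 \<Longrightarrow> bb \<theta> $ j = \<theta>\<^sup>2 * b $ j"
  shows "(ssp_dense_output A bb \<and> dense_order_ge_2 A bb) \<and>
    (\<forall>r. ssp_coeff A b = ereal r \<longrightarrow> (b v* resolvent A r) \<bullet> 1 \<le> 1 - r / 4 \<longrightarrow>
       dense_ssp_coeff A bb = ssp_coeff A b) \<and>
    (ssp_coeff A b \<le> 2 \<longrightarrow> dense_ssp_coeff A bb = ssp_coeff A b)"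
proof -
  have bb: "bb \<theta> = (\<theta> - \<theta>\<^sup>2) *\<^sub>R axis i1 1 + \<theta>\<^sup>2 *\<^sub>R b" if "\<theta> \<in> {0..1}" for \<theta>
    using bb_first[OF that] bb_other[OF that]
    by (auto simp: vec_eq_iff axis_def algebra_simps)
  have dense: "r \<in> dense_ssp_radii A bb"
    if "r \<in> ssp_radii A b"
      and "\<And>\<theta>. \<theta> \<in> {0..1} \<Longrightarrow>
        r * (\<theta> - \<theta>\<^sup>2) + \<theta>\<^sup>2 * (r * ((b v* resolvent A r) \<bullet> 1)) \<le> 1" for r
    using that weight_cond_dense[OF first_row] by (auto simp: ssp_radii_def dense_ssp_radii_def bb)
  have small: "r \<in> dense_ssp_radii A bb" if r: "r \<in> ssp_radii A b" "r \<le> 2" for r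
  proof (rule dense[OF r(1)])
    fix \<theta> :: real assume \<theta>: "\<theta> \<in> {0..1}"
    have "r * (\<theta> - \<theta>\<^sup>2) \<le> 2 * (\<theta> - \<theta>\<^sup>2)"
      using r \<theta> by (intro mult_right_mono) (auto simp: power2_eq_square mult_left_le)
    moreover have "\<theta>\<^sup>2 * (r * ((b v* resolvent A r) \<bullet> 1)) \<le> \<theta>\<^sup>2 * 1"
      using r by (intro mult_left_mono) (auto simp: ssp_radii_def weight_cond_def)
    moreover have "2 * (\<theta> - \<theta>\<^sup>2) + \<theta>\<^sup>2 * 1 = 1 - (1 - \<theta>)\<^sup>2"
      by (simp add: power2_eq_square algebra_simps)
    ultimately show "r * (\<theta> - \<theta>\<^sup>2) + \<theta>\<^sup>2 * (r * ((b v* resolvent A r) \<bullet> 1)) \<le> 1"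
      using zero_le_power2[of "1 - \<theta>"] by linarith
  qed
  \<comment> \<open>At \<theta> = 1 the dense condition is the condition on
    \<open>b\<close>.\<close>
  have "bb 1 = b"
    using bb[of 1] by simp
  then have "dense_ssp_radii A bb \<subseteq> ssp_radii A b"
    by (force simp: ssp_radii_def dense_ssp_radii_def)
  then have le: "dense_ssp_coeff A bb \<le> ssp_coeff A b"
    unfolding dense_ssp_coeff_def ssp_coeff_def
    by (rule sup_radius_mono) (auto simp: ssp_radii_def)
  have "\<exists>r\<in>ssp_radii A b. 0 < r"
    using ssp by (auto simp: ssp_coeff_def sup_radius_def less_SUP_iff split: if_splits)
  then obtain r where r: "r \<in> ssp_radii A b" "0 < r"
    by blast
  have "min r 2 \<in> dense_ssp_radii A bb"
    by (rule small[OF ssp_radii_downward[OF r(1)]]) (use r in auto)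
  then have "ereal (min r 2) \<le> dense_ssp_coeff A bb"
    unfolding dense_ssp_coeff_def by (rule sup_radius_ge)
  moreover have "0 < ereal (min r 2)"
    using r by simp
  ultimately have "ssp_dense_output A bb"
    unfolding ssp_dense_output_def by (rule less_le_trans[rotated])
  moreover have "dense_order_ge_2 A bb"
  proof -
    have "abscissas A $ i1 = 0"
      by (simp add: abscissas_def first_row)
    \<comment> \<open>Both order conditions are instances: \<open>f\<close> constantly 1, and
      \<open>f\<close> the abscissas, where the term at \<open>i1\<close> drops out.\<close>
    moreover have "(\<Sum>j\<in>UNIV. bb \<theta> $ j * f j)
        = (\<theta> - \<theta>\<^sup>2) * f i1 + \<theta>\<^sup>2 * (\<Sum>j\<in>UNIV. b $ j * f j)" if "\<theta> \<in> {0..1}" for \<theta> f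
    proof -
      have "(\<Sum>j\<in>UNIV. axis i1 1 $ j * f j) = f i1"
        using inner_axis'[of i1 1 "\<chi> j. f j"] by (simp add: inner_vec_def)
      then show ?thesis
        by (simp add: bb[OF that] distrib_right sum.distrib mult.assoc flip: sum_distrib_left)
    qed
    from this[of _ "\<lambda>_. 1"] this[of _ "\<lambda>j. abscissas A $ j"] calculation
    show ?thesis
      using order by (simp add: dense_order_ge_2_def rk_order_ge_2_def)
  qed
  moreover have "dense_ssp_coeff A bb = ssp_coeff A b"
    if C: "ssp_coeff A b = ereal C" and beta: "(b v* resolvent A C) \<bullet> 1 \<le> 1 - C / 4" for C
  proof -
    have "0 < C"
      using ssp C by simp
    \<comment> \<open>The hypothesis \<open>beta\<close> concerns the resolvent at \<open>C\<close>
      only, so the supremum has to be attained.\<close>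
    then have "C \<in> ssp_radii A b"
      using sup_radius_mem[OF closed_ssp_radii] C by (simp add: ssp_coeff_def)
    then have "C \<in> dense_ssp_radii A bb"
    proof (rule dense)
      fix \<theta> :: real
      have "\<theta>\<^sup>2 * (C * ((b v* resolvent A C) \<bullet> 1)) \<le> \<theta>\<^sup>2 * (C * (1 - C / 4))"
        using beta \<open>0 < C\<close> by (intro mult_left_mono) auto
      \<comment> \<open>Completing the square in \<theta> explains the constant 1/4 in
        \<open>beta\<close>.\<close>
      moreover have "C * (\<theta> - \<theta>\<^sup>2) + \<theta>\<^sup>2 * (C * (1 - C / 4)) = 1 - (1 - C * \<theta> / 2)\<^sup>2"
        by (simp add: power2_eq_square field_simps)
      ultimately show "C * (\<theta> - \<theta>\<^sup>2) + \<theta>\<^sup>2 * (C * ((b v* resolvent A C) \<bullet> 1)) \<le> 1"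
        using zero_le_power2[of "1 - C * \<theta> / 2"] by linarith
    qed
    then have "ereal C \<le> dense_ssp_coeff A bb"
      unfolding dense_ssp_coeff_def by (rule sup_radius_ge)
    with le C show ?thesis
      by simp
  qed
  moreover have "dense_ssp_coeff A bb = ssp_coeff A b" if "ssp_coeff A b \<le> 2"
  proof -
    have "r \<le> 2" if "r \<in> ssp_radii A b" for r
      using order_trans[OF sup_radius_ge[OF that] \<open>ssp_coeff A b \<le> 2\<close>[unfolded ssp_coeff_def]]
      by (simp add: numeral_eq_ereal)
    then have "ssp_radii A b \<subseteq> dense_ssp_radii A bb"
      using small by blast
    then have "ssp_coeff A b \<le> dense_ssp_coeff A bb"
      unfolding dense_ssp_coeff_def ssp_coeff_def
      by (rule sup_radius_mono) (auto simp: dense_ssp_radii_def)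
    with le show ?thesis
      by (rule antisym)
  qed
  ultimately show ?thesis
    by blast
qed

end
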